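(* Fix an integer $n\ge2$ and put $$\gamma_n=\sqrt{1-\frac{n-1}{n^2}}<1.$$ Let $T_0\subset\mathbb R^3$ be any tetrahedron and $k\ge0$. Every depth-$k$ descendant $T$ of $T_0$ under longest-edge $n$-section (with arbitrary choices when several edges are longest) satisfies $$h_T\le\gamma_n^{\lfloor k/6\rfloor}\,h_{T_0}.$$ Consequently, for every sequence of partitions $(\mathcal G_k)_{k\ge0}$ produced by the classical LE $n$-section algorithm from a finite tetrahedral partition $\mathcal G_0$, one has $h(\mathcal G_k)\to0$ as $k\to\infty$, whether or not the partitions $\mathcal G_k$ are conforming.
   Context: A tetrahedron is the convex hull of four affinely independent points of $\mathbb R^3$; $h_T=\operatorname{diam}T$ is the length of its longest edge. Edge $n$-section: for $T=\operatorname{conv}\{A,B,C,D\}$ and its edge $e=AB$, put $P_j=(1-j/n)A+(j/n)B$ ($0\le j\le n$) and $\mathcal N_n(T,e)=\{\operatorname{conv}\{P_{j-1},P_j,C,D\}:1\le j\le n\}$. A depth-$k$ descendant of $T_0$ under longest-edge $n$-section is a tetrahedron $T=T_k$ for which there is a chain $T_0,T_1,\dots,T_k$ such that for each $0\le i<k$ one has $T_{i+1}\in\mathcal N_n(T_i,e_i)$ for some edge $e_i$ of $T_i$ with $|e_i|=h_{T_i}$. A tetrahedral partition of a bounded polyhedral domain $\Omega\subset\mathbb R^3$ is a finite collection of tetrahedra with pairwise disjoint interiors and union $\overline\Omega$; it is conforming if the intersection of any two distinct elements is empty or a complete common vertex, edge, or triangular face; $h(\mathcal T)=\max_{T\in\mathcal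 T}h_T$. Classical LE $n$-section algorithm: start from a finite tetrahedral partition $\mathcal G_0$. Given $\mathcal G_k$, choose independently for every $T\in\mathcal G_k$ an edge $e_T$ with $|e_T|=h_T$ (arbitrarily among longest edges) and set $\mathcal G_{k+1}=\bigcup_{T\in\mathcal G_k}\mathcal N_n(T,e_T)$. *)

theory Defs
  imports "HOL-Analysis.Analysis"
begin

abbreviation tetrahedron :: "(real^3) set \<Rightarrow> bool" where
  "tetrahedron T \<equiv> 3 simplex T"

text \<open>Edges are segments, so their length is their diameter.\<close>

definition longest_edge :: "(real^3) set \<Rightarrow> (real^3) set \<Rightarrow> bool" where
  "longest_edge T e \<longleftrightarrow> e edge_of T \<and> diameter e = diameter T"

definition section_point :: "nat \<Rightarrow> real^3 \<Rightarrow> real^3 \<Rightarrow> nat \<Rightarrow> real^3" where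
  "section_point n A B j = (1 - real j / real n) *\<^sub>R A + (real j / real n) *\<^sub>R B"

text \<open>The labelling of the vertices of \<open>T\<close> is determined by \<open>T\<close> and \<open>e\<close> up to exchanging
  \<open>A\<close> with \<open>B\<close> and \<open>C\<close> with \<open>D\<close>. Neither exchange changes the family of pieces: the first
  one only replaces the index \<open>j\<close> by \<open>n + 1 - j\<close>.\<close>

definition edge_section :: "nat \<Rightarrow> (real^3) set \<Rightarrow> (real^3) set \<Rightarrow> (real^3) set set" where
  "edge_section n T e =
     {convex hull {section_point n A B (j - 1), section_point n A B j, C, D} | A B C D j.
        distinct [A, B, C, D] \<and> \<not> affine_dependent {A, B, C, D} \<and>
        T = convex hull {A, B, C, D} \<and> e = closed_segment A B \<and> 1 \<le> j \<and> j \<le> n}"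

definition descendant :: "nat \<Rightarrow> (real^3) set \<Rightarrow> nat \<Rightarrow> (real^3) set \<Rightarrow> bool" where
  "descendant n T0 k T \<longleftrightarrow>
     (\<exists>S :: nat \<Rightarrow> (real^3) set. S 0 = T0 \<and> S k = T \<and>
        (\<forall>i<k. \<exists>e. longest_edge (S i) e \<and> S (Suc i) \<in> edge_section n (S i) e))"

text \<open>A domain is a nonempty connected open set. It need not be convex, nor have a manifold
  boundary; polyhedrality only asks that its closure be a finite union of polytopes.\<close>

definition bounded_polyhedral_domain :: "(real^3) set \<Rightarrow> bool" where
  "bounded_polyhedral_domain \<Omega> \<longleftrightarrow>
     open \<Omega> \<and> connected \<Omega> \<and> \<Omega> \<noteq> {} \<and> bounded \<Omega> \<and>
     (\<exists>\<P>. finite \<P> \<and> (\<forall>P\<in>\<P>. polytope P) \<and> closure \<Omega> = \<Union>\<P>)"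

definition tetrahedral_partition :: "(real^3) set \<Rightarrow> (real^3) set set \<Rightarrow> bool" where
  "tetrahedral_partition \<Omega> \<T> \<longleftrightarrow>
     finite \<T> \<and> (\<forall>T\<in>\<T>. tetrahedron T) \<and>
     pairwise (\<lambda>S T. interior S \<inter> interior T = {}) \<T> \<and> \<Union>\<T> = closure \<Omega>"

definition mesh_size :: "(real^3) set set \<Rightarrow> real" where
  "mesh_size \<T> = Max (diameter ` \<T>)"

definition le_section_step :: "nat \<Rightarrow> (real^3) set set \<Rightarrow> (real^3) set set \<Rightarrow> bool" where
  "le_section_step n \<G> \<G>' \<longleftrightarrow>
     (\<exists>e. (\<forall>T\<in>\<G>. longest_edge T (e T)) \<and> \<G>' = (\<Union>T\<in>\<G>. edge_section n T (e T)))"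

definition contraction_factor :: "nat \<Rightarrow> real" where
  "contraction_factor n = sqrt (1 - (real n - 1) / (real n)\<^sup>2)"

end

theory Submission
  imports Defs
begin

text \<open>
  Fix a threshold \<open>c\<close> and call an edge long if it is longer than \<open>c\<close>. Let a longest edge \<open>AB\<close>, of
  length \<open>d\<close>, be cut at \<open>P = (1 - t) A + t B\<close> with \<open>t = i/n\<close> and \<open>0 < i < n\<close>. Stewart's theorem gives
  \<open>\<bar>PC\<bar>\<^sup>2 = (1 - t) \<bar>AC\<bar>\<^sup>2 + t \<bar>BC\<bar>\<^sup>2 - t (1 - t) d\<^sup>2 \<le> (1 - t (1 - t)) d\<^sup>2\<close>, and
  \<open>t (1 - t) \<ge> (n - 1) / n\<^sup>2\<close>, so that \<open>\<bar>PC\<bar> \<le> \<gamma> d\<close>, where \<open>\<gamma>\<close> is the contraction factor; the piece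
  \<open>d/n\<close> of the edge \<open>AB\<close> is no longer than \<open>\<gamma> d\<close> either. Hence if \<open>c \<ge> \<gamma> d\<close>, then every long edge
  of a piece is already an edge of the parent. It is not \<open>AB\<close> itself, whose interior is cut;
  and \<open>AB\<close> is long as soon as any edge is. So each section destroys a long edge while there is
  one, and creates none (\<open>long_edges_section\<close>).

  A tetrahedron \<open>T\<close> has six edges. Diameters do not increase under sections, so the threshold
  \<open>c = \<gamma> diam T\<close> is admissible for all descendants of \<open>T\<close>, and after six sections no
  long edge is left: the diameter is then at most \<open>\<gamma> diam T\<close> (\<open>six_sections_contract\<close>). Iterating
  this over blocks of six sections gives the rate. The bound on descendants is uniform over the
  finitely many elements of the initial partition, and therefore it forces the mesh size to zero.

  The vertices of a tetrahedron are represented as its extreme points. They are determined by the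
  set alone, so consecutive sections need no common labelling of vertices.
\<close>

section \<open>The contraction factor and the lengths of new edges\<close>

lemma section_ratio_bounds:
  assumes "2 \<le> n"
  shows "0 < (real n - 1) / (real n)\<^sup>2" "(real n - 1) / (real n)\<^sup>2 \<le> 1 - (1 / real n)\<^sup>2"
proof -
  have n: "2 \<le> real n" using assms by simp
  then show "0 < (real n - 1) / (real n)\<^sup>2" by simp
  have "real n \<le> real n * real n" using n by simp
  then show "(real n - 1) / (real n)\<^sup>2 \<le> 1 - (1 / real n)\<^sup>2"
    using n by (simp add: field_simps power2_eq_square)
qed

lemma contraction_factor_bounds:
  assumes "2 \<le> n"
  shows "0 \<le> contraction_factor n" "contraction_factor n < 1" "1 / real n \<le> contraction_factor n"
    "(contraction_factor n)\<^sup>2 = 1 - (real n - 1) / (real n)\<^sup>2"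
proof -
  note b = section_ratio_bounds[OF assms]
  have sq: "(1 / real n)\<^sup>2 \<le> 1 - (real n - 1) / (real n)\<^sup>2" using b(2) by linarith
  have nonneg: "0 \<le> 1 - (real n - 1) / (real n)\<^sup>2"
    using order_trans[OF zero_le_power2 sq] .
  show "0 \<le> contraction_factor n" "(contraction_factor n)\<^sup>2 = 1 - (real n - 1) / (real n)\<^sup>2"
    using nonneg by (simp_all add: contraction_factor_def)
  show "contraction_factor n < 1" using b(1) by (simp add: contraction_factor_def)
  show "1 / real n \<le> contraction_factor n"
    unfolding contraction_factor_def using sq by (rule real_le_rsqrt)
qed

lemma stewart:
  fixes A B C :: "'a::real_inner"
  shows "(dist ((1 - t) *\<^sub>R A + t *\<^sub>R B) C)\<^sup>2 =
    (1 - t) * (dist A C)\<^sup>2 + t * (dist B C)\<^sup>2 - t * (1 - t) * (dist A B)\<^sup>2"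
proof -
  define u where "u = A - C"
  define v where "v = B - C"
  have points: "(1 - t) *\<^sub>R A + t *\<^sub>R B - C = (1 - t) *\<^sub>R u + t *\<^sub>R v" "A - B = u - v"
    by (simp_all add: u_def v_def algebra_simps)
  have squares: "((1 - t) *\<^sub>R u + t *\<^sub>R v) \<bullet> ((1 - t) *\<^sub>R u + t *\<^sub>R v) =
      (1 - t)\<^sup>2 * (u \<bullet> u) + 2 * (t * (1 - t)) * (u \<bullet> v) + t\<^sup>2 * (v \<bullet> v)"
    "(u - v) \<bullet> (u - v) = u \<bullet> u - 2 * (u \<bullet> v) + v \<bullet> v"
    by (simp add: inner_add_left inner_add_right inner_commute[of v u], algebra)
      (simp add: inner_diff_left inner_diff_right inner_commute[of v u])
  show ?thesis
    unfolding dist_norm power2_norm_eq_inner u_def[symmetric] v_def[symmetric] points squares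
    by algebra
qed

lemma dist_section_point_le:
  assumes n: "2 \<le> n" and i: "0 < i" "i < n"
    and AB: "dist A B = d" and AC: "dist A C \<le> d" and BC: "dist B C \<le> d"
  shows "dist (section_point n A B i) C \<le> contraction_factor n * d"
proof -
  define t where "t = real i / real n"
  have n0: "0 < real n" using n by simp
  have t: "0 \<le> t" "t \<le> 1" using i n0 by (simp_all add: t_def)
  have d: "0 \<le> d" using AB zero_le_dist by metis
  \<comment> \<open>The product \<open>i (n - i)\<close> is smallest at the two ends of the range \<open>0 < i < n\<close>.\<close>
  have "0 \<le> (real i - 1) * (real n - 1 - real i)" using i by simp
  then have "real n - 1 \<le> real i * (real n - real i)" by (simp add: algebra_simps)
  then have "(real n - 1) / (real n)\<^sup>2 \<le> real i * (real n - real i) / (real n)\<^sup>2"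
    by (rule divide_right_mono) simp
  also have "\<dots> = t * (1 - t)" using n0 by (simp add: t_def field_simps power2_eq_square)
  finally have tt: "(real n - 1) / (real n)\<^sup>2 \<le> t * (1 - t)" .
  have "(dist A C)\<^sup>2 \<le> d\<^sup>2" "(dist B C)\<^sup>2 \<le> d\<^sup>2" using AC BC by (auto intro: power_mono)
  then have "(1 - t) * (dist A C)\<^sup>2 + t * (dist B C)\<^sup>2 \<le> (1 - t) * d\<^sup>2 + t * d\<^sup>2"
    using t by (intro add_mono mult_left_mono) auto
  then have "(dist (section_point n A B i) C)\<^sup>2 \<le> (1 - t * (1 - t)) * d\<^sup>2"
    unfolding section_point_def t_def[symmetric] stewart AB by (simp add: algebra_simps)
  also have "\<dots> \<le> (contraction_factor n)\<^sup>2 * d\<^sup>2"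
    using tt contraction_factor_bounds(4)[OF n] by (intro mult_right_mono) auto
  finally have "(dist (section_point n A B i) C)\<^sup>2 \<le> (contraction_factor n * d)\<^sup>2"
    by (simp add: power_mult_distrib)
  then show ?thesis
    by (rule power2_le_imp_le) (simp add: d contraction_factor_bounds(1)[OF n])
qed

lemma dist_consecutive_section_points:
  assumes "1 \<le> j"
  shows "dist (section_point n A B (j - 1)) (section_point n A B j) = dist A B / real n"
proof -
  have "section_point n A B (j - 1) - section_point n A B j = (1 / real n) *\<^sub>R (A - B)"
    using assms
    by (simp add: section_point_def of_nat_diff diff_divide_distrib algebra_simps)
  then show ?thesis by (simp add: dist_norm)
qed

lemma section_point_in_segment:
  assumes "i \<le> n" "0 < n"
  shows "section_point n A B i \<in> closed_segment A B"
  unfolding section_point_def in_segment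
  using assms by (intro exI[of _ "real i / real n"]) auto

section \<open>Tetrahedra and their pieces\<close>

lemma bounded_tetrahedron:
  assumes "tetrahedron T"
  shows "bounded T"
  using assms by (intro compact_imp_bounded compact_simplex)

lemma tetrahedron_longest_edgeE:
  assumes "tetrahedron T" "longest_edge T e"
  obtains A B C D where "distinct [A, B, C, D]" "\<not> affine_dependent {A, B, C, D}"
    "T = convex hull {A, B, C, D}" "e = closed_segment A B"
proof -
  obtain V where V: "\<not> affine_dependent V" "int (card V) = 3 + 1" "T = convex hull V"
    using assms(1) by (auto simp: simplex_def)
  have fin: "finite V" using V(1) by (rule aff_independent_finite)
  have e: "e face_of convex hull V" "aff_dim e = 1"
    using assms(2) V(3) by (auto simp: longest_edge_def edge_of_def)
  obtain U where U: "U \<subseteq> V" "e = convex hull U"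
    using e(1) V(1) by (auto simp: face_of_convex_hull_affine_independent)
  have "\<not> affine_dependent U" using U(1) V(1) affine_dependent_subset by blast
  then have "card U = 2"
    using e(2) U(2) aff_dim_affine_independent[of U] by (simp add: aff_dim_convex_hull)
  moreover have "card (V - U) = 2"
    using V(2) U(1) fin \<open>card U = 2\<close> by (simp add: card_Diff_subset finite_subset)
  ultimately obtain A B C D where AB: "U = {A, B}" "A \<noteq> B" and CD: "V - U = {C, D}" "C \<noteq> D"
    by (auto simp: card_2_iff)
  have "V = {A, B, C, D}" using AB CD U(1) by blast
  moreover have "distinct [A, B, C, D]" using AB CD by auto
  moreover have "e = closed_segment A B" using U(2) AB by (simp add: segment_convex_hull)
  ultimately show thesis using that V by metis
qed

text \<open>The cut points span the line \<open>AB\<close>, so a piece has the same affine span as \<open>T\<close>; four points cannot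
  have a span of dimension three unless they are affinely independent.\<close>

lemma edge_section_tetrahedron:
  assumes n: "2 \<le> n" and T': "T' \<in> edge_section n T e"
  shows "tetrahedron T'"
proof -
  obtain A B C D j where dis: "distinct [A, B, C, D]" and ind: "\<not> affine_dependent {A, B, C, D}"
    and j: "1 \<le> j" "j \<le> n"
    and T'_eq: "T' = convex hull {section_point n A B (j - 1), section_point n A B j, C, D}"
    using T' by (auto simp: edge_section_def)
  define P where "P = section_point n A B (j - 1)"
  define Q where "Q = section_point n A B j"
  define W where "W = {P, Q, C, D}"
  have n0: "real n \<noteq> 0" using n by simp
  \<comment> \<open>Extrapolation: the line is traversed in \<open>n\<close> equal steps \<open>Q - P\<close>, and \<open>P\<close> comes after
    \<open>j - 1\<close> of them.\<close>
  have step: "real n *\<^sub>R (Q - P) = B - A"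
  proof -
    have "Q - P = (1 / real n) *\<^sub>R (B - A)"
      using j(1)
      by (simp add: P_def Q_def section_point_def of_nat_diff diff_divide_distrib algebra_simps)
    then show ?thesis using n0 by simp
  qed
  have P_eq: "P = A + (real (j - 1) / real n) *\<^sub>R (B - A)"
    by (simp add: P_def section_point_def algebra_simps)
  have onP: "P + s *\<^sub>R (Q - P) \<in> affine hull {P, Q}" for s
  proof -
    have "P + s *\<^sub>R (Q - P) = (1 - s) *\<^sub>R P + s *\<^sub>R Q" by (simp add: algebra_simps)
    moreover have "(1 - s) + s = 1" by simp
    ultimately show ?thesis unfolding affine_hull_2 by blast
  qed
  have "A = P + (- real (j - 1)) *\<^sub>R (Q - P)"
    using P_eq n0 unfolding step[symmetric] by (simp add: eq_diff_eq)
  then have A: "A \<in> affine hull {P, Q}" using onP by metis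
  have "B = A + real n *\<^sub>R (Q - P)" using step by simp
  also have "\<dots> = P + (real n - real (j - 1)) *\<^sub>R (Q - P)"
    using \<open>A = P + _\<close> by (simp add: algebra_simps)
  finally have B: "B \<in> affine hull {P, Q}" using onP by metis
  have "affine hull {P, Q} \<subseteq> affine hull W" by (rule hull_mono) (auto simp: W_def)
  then have "{A, B, C, D} \<subseteq> affine hull W"
    using A B by (auto simp: W_def intro: hull_inc)
  then have "aff_dim {A, B, C, D} \<le> aff_dim W"
    using aff_dim_subset by (metis aff_dim_affine_hull)
  moreover have "aff_dim {A, B, C, D} = 3"
    using aff_dim_affine_independent[OF ind] dis by simp
  moreover have "card W \<le> 4"
    unfolding W_def by (simp add: card_insert_if)
  moreover have "aff_dim W \<le> int (card W) - 1"
    by (intro aff_dim_le_card) (simp add: W_def)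
  ultimately have "card W = 4" "aff_dim W = int (card W) - 1" by auto
  then have "\<not> affine_dependent W"
    by (simp add: affine_independent_iff_card W_def)
  then show ?thesis
    unfolding simplex_def using \<open>card W = 4\<close> T'_eq
    by (intro exI[of _ W]) (simp add: W_def P_def Q_def)
qed

lemma edge_section_subset:
  assumes "2 \<le> n" "T' \<in> edge_section n T e"
  shows "T' \<subseteq> T"
proof -
  obtain A B C D j where T: "T = convex hull {A, B, C, D}" and j: "1 \<le> j" "j \<le> n"
    and T': "T' = convex hull {section_point n A B (j - 1), section_point n A B j, C, D}"
    using assms(2) by (auto simp: edge_section_def)
  have "closed_segment A B \<subseteq> T"
    unfolding T segment_convex_hull by (rule hull_mono) auto
  moreover have "C \<in> T" "D \<in> T" by (auto simp: T intro: hull_inc)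
  ultimately have "{section_point n A B (j - 1), section_point n A B j, C, D} \<subseteq> T"
    using section_point_in_segment[of "j - 1" n A B] section_point_in_segment[of j n A B]
      assms(1) j by auto
  then show ?thesis unfolding T' by (rule hull_minimal) (simp add: T)
qed

lemma edge_section_nonempty:
  assumes "2 \<le> n" "tetrahedron T" "longest_edge T e"
  shows "edge_section n T e \<noteq> {}"
proof -
  obtain A B C D where ABCD: "distinct [A, B, C, D]" "\<not> affine_dependent {A, B, C, D}"
    "T = convex hull {A, B, C, D}" "e = closed_segment A B"
    using tetrahedron_longest_edgeE[OF assms(2,3)] .
  then have "convex hull {section_point n A B (1 - 1), section_point n A B 1, C, D} \<in> edge_section n T e"
    unfolding edge_section_def using assms(1)
    by (intro CollectI exI[of _ A] exI[of _ B] exI[of _ C] exI[of _ D] exI[of _ "1::nat"]) simp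
  then show ?thesis by blast
qed

lemma finite_edge_section:
  assumes "tetrahedron T"
  shows "finite (edge_section n T e)"
proof -
  obtain V where V: "\<not> affine_dependent V" "T = convex hull V"
    using assms by (auto simp: simplex_def)
  have fin: "finite V" using V(1) by (rule aff_independent_finite)
  define piece where "piece = (\<lambda>(A, B, C, D, j).
    convex hull {section_point n A B (j - 1), section_point n A B j, C, D})"
  have "edge_section n T e \<subseteq> piece ` (V \<times> V \<times> V \<times> V \<times> {1..n})"
  proof
    fix T' assume "T' \<in> edge_section n T e"
    then obtain A B C D j where *: "\<not> affine_dependent {A, B, C, D}" "T = convex hull {A, B, C, D}"
      "1 \<le> j" "j \<le> n"
      "T' = convex hull {section_point n A B (j - 1), section_point n A B j, C, D}"
      unfolding edge_section_def by blast
    \<comment> \<open>Both sets consist of the extreme points of \<open>T\<close>.\<close>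
    have "{A, B, C, D} = V"
      using extreme_point_of_convex_hull_affine_independent[OF *(1), folded *(2)]
        extreme_point_of_convex_hull_affine_independent[OF V(1), folded V(2)] by (intro set_eqI) simp
    then show "T' \<in> piece ` (V \<times> V \<times> V \<times> V \<times> {1..n})"
      using * by (intro image_eqI[of _ _ "(A, B, C, D, j)"]) (auto simp: piece_def)
  qed
  then show ?thesis by (rule finite_subset) (simp add: fin)
qed

section \<open>Counting long edges\<close>

text \<open>For \<open>c \<ge> 0\<close> the two points of such a pair are distinct, so in a tetrahedron these are the
  vertex sets of the edges longer than \<open>c\<close>.\<close>

definition long_edges :: "real \<Rightarrow> 'a::real_normed_vector set \<Rightarrow> 'a set set" where
  "long_edges c T = {{x, y} | x y. x extreme_point_of T \<and> y extreme_point_of T \<and> c < dist x y}"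

lemma
  assumes "tetrahedron T" "0 \<le> c"
  shows finite_long_edges: "finite (long_edges c T)"
    and card_long_edges_le_6: "card (long_edges c T) \<le> 6"
proof -
  obtain V where V: "\<not> affine_dependent V" "card V = 4" "T = convex hull V"
    using assms(1) by (auto simp: simplex_def)
  have fin: "finite V" using V(1) by (rule aff_independent_finite)
  have sub: "long_edges c T \<subseteq> {E. E \<subseteq> V \<and> card E = 2}"
    using extreme_point_of_convex_hull_affine_independent[OF V(1)] V(3) assms(2)
    by (force simp: long_edges_def card_2_iff)
  have fin2: "finite {E. E \<subseteq> V \<and> card E = 2}" using fin by simp
  have "card {E. E \<subseteq> V \<and> card E = 2} = 6"
    using n_subsets[OF fin, of 2] V(2) by (simp add: choose_two)
  then show "finite (long_edges c T)" "card (long_edges c T) \<le> 6"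
    using finite_subset[OF sub fin2] card_mono[OF fin2 sub] by simp_all
qed

lemma diameter_le_if_no_long_edges:
  assumes "tetrahedron T" "0 \<le> c" "long_edges c T = {}"
  shows "diameter T \<le> c"
proof -
  obtain V where V: "\<not> affine_dependent V" "card V = 4" "T = convex hull V"
    using assms(1) by (auto simp: simplex_def)
  have fin: "finite V" using V(1) by (rule aff_independent_finite)
  have "V \<noteq> {}" using V(2) by auto
  then obtain u v where uv: "u \<in> V" "v \<in> V"
    and max: "\<forall>x\<in>convex hull V. \<forall>y\<in>convex hull V. norm (x - y) \<le> norm (u - v)"
    using simplex_extremal_le[OF fin] by blast
  have "\<not> c < dist u v"
    using assms(3) uv extreme_point_of_convex_hull_affine_independent[OF V(1)]
    by (auto simp: long_edges_def V(3))
  then show ?thesis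
    using max assms(2) V(3) by (intro diameter_le) (force simp: dist_norm)+
qed

text \<open>The long edges of a piece are long edges of \<open>T\<close> other than the divided edge \<open>AB\<close>: an edge at an
  interior cut point is short by Stewart's theorem, and so is the edge between the two cut
  points. If \<open>AB\<close> is not long then no edge is, and the truncated subtraction is harmless.\<close>

lemma long_edges_section:
  assumes n: "2 \<le> n" and T: "tetrahedron T" and e: "longest_edge T e"
    and T': "T' \<in> edge_section n T e" and c: "contraction_factor n * diameter T \<le> c"
  shows "card (long_edges c T') \<le> card (long_edges c T) - 1"
proof -
  obtain A B C D j where dis: "distinct [A, B, C, D]" and ind: "\<not> affine_dependent {A, B, C, D}"
    and T_eq: "T = convex hull {A, B, C, D}" and e_eq: "e = closed_segment A B"
    and j: "1 \<le> j" "j \<le> n"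
    and T'_eq: "T' = convex hull {section_point n A B (j - 1), section_point n A B j, C, D}"
    using T' unfolding edge_section_def by blast
  define P where "P = section_point n A B (j - 1)"
  define Q where "Q = section_point n A B j"
  define d where "d = diameter T"
  have bdd: "bounded T" using T by (rule bounded_tetrahedron)
  have d0: "0 \<le> d" using bdd by (simp add: d_def diameter_ge_0)
  have c0: "0 \<le> c"
    using c d0 contraction_factor_bounds(1)[OF n] by (metis d_def mult_nonneg_nonneg order_trans)
  have le_d: "dist x y \<le> d" if "x \<in> {A, B, C, D}" "y \<in> {A, B, C, D}" for x y
    unfolding d_def using that
    by (intro diameter_bounded_bound[OF bdd]) (auto simp: T_eq intro: hull_inc)
  have AB: "dist A B = d"
  proof (rule antisym)
    have "diameter (closed_segment A B) \<le> dist A B"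
      unfolding segment_convex_hull
      by (intro diameter_le)
        (use simplex_extremal_le[of "{A, B}"] in \<open>force simp: dist_norm norm_minus_commute\<close>)+
    then show "d \<le> dist A B" using e e_eq by (simp add: longest_edge_def d_def)
  qed (simp add: le_d)
  have ext: "x extreme_point_of T \<longleftrightarrow> x \<in> {A, B, C, D}" for x
    unfolding T_eq by (rule extreme_point_of_convex_hull_affine_independent[OF ind])
  have inner: "dist (section_point n A B i) C \<le> c \<and> dist (section_point n A B i) D \<le> c"
    if "0 < i" "i < n" for i
    using dist_section_point_le[OF n that AB le_d le_d, of C]
      dist_section_point_le[OF n that AB le_d le_d, of D] c by (auto simp: d_def)
  have P: "P = A \<or> dist P C \<le> c \<and> dist P D \<le> c"
    using inner[of "j - 1"] j by (cases "j = 1") (auto simp: P_def section_point_def)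
  have Q: "Q = B \<or> dist Q C \<le> c \<and> dist Q D \<le> c"
    using inner[of j] j n by (cases "j = n") (auto simp: Q_def section_point_def)
  have "1 / real n * d \<le> contraction_factor n * d"
    using contraction_factor_bounds(3)[OF n] d0 by (rule mult_right_mono)
  then have PQ: "dist P Q \<le> c"
    using dist_consecutive_section_points[OF j(1), of n A B] AB c by (simp add: P_def Q_def d_def)
  have cuts: "dist z w \<le> c" if "z \<in> {P, Q}" "w \<in> {P, Q}" for z w
    using that PQ c0 by (auto simp: dist_commute)
  have old: "z \<in> {A, B, C, D}"
    if "z \<in> {P, Q, C, D}" "w \<in> {P, Q, C, D}" "c < dist z w" for z w
  proof (cases "z \<in> {P, Q}")
    case True
    then have "w = C \<or> w = D" using cuts[of z w] that by auto
    then show ?thesis using True P Q that(3) by auto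
  qed (use that(1) in auto)
  have "long_edges c T' \<subseteq> long_edges c T - {{A, B}}"
  proof
    fix E assume "E \<in> long_edges c T'"
    then obtain x y where E: "E = {x, y}" and long: "c < dist x y"
      and "x extreme_point_of T'" "y extreme_point_of T'"
      by (auto simp: long_edges_def)
    then have xy: "x \<in> {P, Q, C, D}" "y \<in> {P, Q, C, D}"
      unfolding T'_eq P_def Q_def by (auto dest: extreme_point_of_convex_hull)
    have "E \<noteq> {A, B}"
    proof
      assume "E = {A, B}"
      then have "x \<notin> {C, D}" "y \<notin> {C, D}" using dis E by (auto simp: doubleton_eq_iff)
      then have "dist x y \<le> c" using xy by (intro cuts) auto
      then show False using long by simp
    qed
    moreover have "x extreme_point_of T" "y extreme_point_of T"
      using old[OF xy long] old[of y x] xy long ext by (simp_all add: dist_commute)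
    ultimately show "E \<in> long_edges c T - {{A, B}}"
      using E long by (auto simp: long_edges_def)
  qed
  then have le: "card (long_edges c T') \<le> card (long_edges c T - {{A, B}})"
    by (intro card_mono finite_Diff finite_long_edges[OF T c0])
  show ?thesis
  proof (cases "{A, B} \<in> long_edges c T")
    case True
    then show ?thesis using le by simp
  next
    case False
    then have "d \<le> c" using ext AB by (force simp: long_edges_def)
    then have "\<not> c < dist x y" if "x extreme_point_of T" "y extreme_point_of T" for x y
      using le_d[of x y] that unfolding ext by linarith
    then have "long_edges c T = {}" unfolding long_edges_def by blast
    then show ?thesis using le by simp
  qed
qed

section \<open>Descendants\<close>

definition le_child :: "nat \<Rightarrow> (real^3) set \<Rightarrow> (real^3) set \<Rightarrow> bool" where
  "le_child n T T' \<longleftrightarrow> (\<exists>e. longest_edge T e \<and> T' \<in> edge_section n T e)"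

lemma descendant_iff_relpowp: "descendant n T0 k T \<longleftrightarrow> (le_child n ^^ k) T0 T"
  unfolding descendant_def le_child_def relpowp_fun_conv by (rule refl)

lemma le_child_relpowp:
  assumes n: "2 \<le> n" and T0: "tetrahedron T0" and T: "(le_child n ^^ k) T0 T"
  shows "tetrahedron T \<and> diameter T \<le> diameter T0"
  using T
proof (induction k arbitrary: T)
  case 0
  then show ?case using T0 by simp
next
  case (Suc k)
  then obtain S where S: "(le_child n ^^ k) T0 S" "le_child n S T" by auto
  have tS: "tetrahedron S" and dS: "diameter S \<le> diameter T0" using Suc.IH[OF S(1)] by auto
  obtain e where e: "T \<in> edge_section n S e" using S(2) by (auto simp: le_child_def)
  have "diameter T \<le> diameter S"
    using edge_section_subset[OF n e] tS
    by (intro diameter_subset bounded_tetrahedron)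
  then show ?case using dS edge_section_tetrahedron[OF n e] by simp
qed

lemma card_long_edges_descendant:
  assumes n: "2 \<le> n" and T0: "tetrahedron T0" and T: "(le_child n ^^ k) T0 T"
    and c: "contraction_factor n * diameter T0 \<le> c" "0 \<le> c"
  shows "card (long_edges c T) \<le> 6 - k"
  using T
proof (induction k arbitrary: T)
  case 0
  then show ?case using card_long_edges_le_6[OF T0 c(2)] by simp
next
  case (Suc k)
  then obtain S where S: "(le_child n ^^ k) T0 S" "le_child n S T" by auto
  obtain e where e: "longest_edge S e" "T \<in> edge_section n S e"
    using S(2) by (auto simp: le_child_def)
  have tS: "tetrahedron S" and dS: "diameter S \<le> diameter T0"
    using le_child_relpowp[OF n T0 S(1)] by auto
  have "contraction_factor n * diameter S \<le> c"
    using mult_left_mono[OF dS contraction_factor_bounds(1)[OF n]] c(1) by linarith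
  from long_edges_section[OF n tS e this] show ?case using Suc.IH[OF S(1)] by simp
qed

lemma six_sections_contract:
  assumes n: "2 \<le> n" and T0: "tetrahedron T0" and T: "(le_child n ^^ 6) T0 T"
  shows "diameter T \<le> contraction_factor n * diameter T0"
proof -
  have tT: "tetrahedron T" using le_child_relpowp[OF n T0 T] by (rule conjunct1)
  have c0: "0 \<le> contraction_factor n * diameter T0"
    by (intro mult_nonneg_nonneg contraction_factor_bounds(1)[OF n] diameter_ge_0
        bounded_tetrahedron T0)
  have "card (long_edges (contraction_factor n * diameter T0) T) = 0"
    using card_long_edges_descendant[OF n T0 T order_refl c0] by simp
  then show ?thesis
    using finite_long_edges[OF tT c0] by (intro diameter_le_if_no_long_edges[OF tT c0]) simp
qed

lemma sections_contract:
  assumes n: "2 \<le> n" and T0: "tetrahedron T0" and T: "(le_child n ^^ k) T0 T"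
  shows "diameter T \<le> contraction_factor n ^ (k div 6) * diameter T0"
  using T
proof (induction k arbitrary: T rule: less_induct)
  case (less k)
  show ?case
  proof (cases "k < 6")
    case True
    then show ?thesis using le_child_relpowp[OF n T0 less.prems] by simp
  next
    case False
    define m where "m = k - 6"
    have k: "k = m + 6" using False by (simp add: m_def)
    obtain S where S: "(le_child n ^^ m) T0 S" "(le_child n ^^ 6) S T"
      using less.prems unfolding k relpowp_add by (auto elim: relcomppE)
    have "diameter T \<le> contraction_factor n * diameter S"
      using six_sections_contract[OF n _ S(2)] le_child_relpowp[OF n T0 S(1)] by simp
    also have "\<dots> \<le> contraction_factor n * (contraction_factor n ^ (m div 6) * diameter T0)"
      using less.IH[OF _ S(1)] k
      by (intro mult_left_mono contraction_factor_bounds(1)[OF n]) simp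
    finally show ?thesis by (simp add: k mult.assoc)
  qed
qed

section \<open>Partitions\<close>

text \<open>Finiteness and nonemptiness make the maximum in the mesh size an actual maximum.\<close>

lemma le_section_step_iterate:
  assumes n: "2 \<le> n" and G0: "finite (\<G> 0)" "\<G> 0 \<noteq> {}" "\<forall>T\<in>\<G> 0. tetrahedron T"
    and step: "\<forall>k. le_section_step n (\<G> k) (\<G> (Suc k))"
  shows "finite (\<G> k) \<and> \<G> k \<noteq> {} \<and> (\<forall>T\<in>\<G> k. \<exists>T0\<in>\<G> 0. (le_child n ^^ k) T0 T)"
proof (induction k)
  case 0
  then show ?case using G0 by auto
next
  case (Suc k)
  have tet: "tetrahedron T" if "T \<in> \<G> k" for T
    using Suc that G0(3) le_child_relpowp[OF n] by blast
  obtain e where e: "\<forall>T\<in>\<G> k. longest_edge T (e T)"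
    and next_eq: "\<G> (Suc k) = (\<Union>T\<in>\<G> k. edge_section n T (e T))"
    using step unfolding le_section_step_def by blast
  have "finite (\<G> (Suc k))" using Suc tet by (simp add: next_eq finite_edge_section)
  moreover have "\<G> (Suc k) \<noteq> {}"
  proof -
    obtain T where T: "T \<in> \<G> k" using Suc by auto
    then have "edge_section n T (e T) \<noteq> {}" using tet e by (intro edge_section_nonempty[OF n]) auto
    then show ?thesis using T by (auto simp: next_eq)
  qed
  moreover have "\<exists>T0\<in>\<G> 0. (le_child n ^^ Suc k) T0 T'" if T': "T' \<in> \<G> (Suc k)" for T'
  proof -
    obtain T where T: "T \<in> \<G> k" "T' \<in> edge_section n T (e T)" using T' next_eq by blast
    obtain T0 where T0: "T0 \<in> \<G> 0" "(le_child n ^^ k) T0 T" using Suc T(1) by blast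
    have "le_child n T T'" using T e by (auto simp: le_child_def)
    with T0 show ?thesis by (meson relpowp_Suc_I)
  qed
  ultimately show ?case by blast
qed

lemma mesh_size_tendsto_0:
  assumes n: "2 \<le> n" and G0: "finite (\<G> 0)" "\<G> 0 \<noteq> {}" "\<forall>T\<in>\<G> 0. tetrahedron T"
    and step: "\<forall>k. le_section_step n (\<G> k) (\<G> (Suc k))"
  shows "(\<lambda>k. mesh_size (\<G> k)) \<longlonglongrightarrow> 0"
proof (rule tendsto_sandwich[OF _ _ tendsto_const])
  have bounds: "0 \<le> mesh_size (\<G> k) \<and>
    mesh_size (\<G> k) \<le> contraction_factor n ^ (k div 6) * mesh_size (\<G> 0)" for k
  proof -
    have Gk: "finite (\<G> k)" "\<G> k \<noteq> {}" "\<forall>T\<in>\<G> k. \<exists>T0\<in>\<G> 0. (le_child n ^^ k) T0 T"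
      using le_section_step_iterate[OF assms] by blast+
    have "mesh_size (\<G> k) \<in> diameter ` \<G> k"
      unfolding mesh_size_def using Gk by (intro Max_in) auto
    then obtain T where T: "T \<in> \<G> k" "mesh_size (\<G> k) = diameter T" by blast
    obtain T0 where T0: "T0 \<in> \<G> 0" "(le_child n ^^ k) T0 T" using Gk(3) T(1) by blast
    have tT0: "tetrahedron T0" using G0(3) T0(1) by blast
    have "bounded T"
      using le_child_relpowp[OF n tT0 T0(2)] bounded_tetrahedron by blast
    then have "0 \<le> diameter T" by (rule diameter_ge_0)
    moreover have "diameter T0 \<le> mesh_size (\<G> 0)"
      unfolding mesh_size_def using G0(1) T0(1) by (intro Max_ge) auto
    then have "contraction_factor n ^ (k div 6) * diameter T0
        \<le> contraction_factor n ^ (k div 6) * mesh_size (\<G> 0)"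
      using contraction_factor_bounds(1)[OF n] by (intro mult_left_mono) auto
    ultimately show ?thesis
      using sections_contract[OF n tT0 T0(2)] T(2) by linarith
  qed
  show "\<forall>\<^sub>F k in sequentially. 0 \<le> mesh_size (\<G> k)" using bounds by simp
  show "\<forall>\<^sub>F k in sequentially. mesh_size (\<G> k) \<le> contraction_factor n ^ (k div 6) * mesh_size (\<G> 0)"
    using bounds by simp
  have "(\<lambda>q. contraction_factor n ^ q) \<longlonglongrightarrow> 0"
    using contraction_factor_bounds[OF n] by (intro LIMSEQ_power_zero) auto
  then have "(\<lambda>k. contraction_factor n ^ (k div 6)) \<longlonglongrightarrow> 0"
    by (rule filterlim_compose) (simp add: filterlim_at_top_div_const_nat)
  then show "(\<lambda>k. contraction_factor n ^ (k div 6) * mesh_size (\<G> 0)) \<longlonglongrightarrow> 0"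
    by (rule tendsto_mult_left_zero)
qed

theorem proposition1:
  fixes n :: nat
  assumes "2 \<le> n"
  shows "contraction_factor n < 1 \<and>
    (\<forall>(T0 :: (real^3) set) (k :: nat) (T :: (real^3) set).
       tetrahedron T0 \<longrightarrow> descendant n T0 k T \<longrightarrow>
       diameter T \<le> contraction_factor n ^ (k div 6) * diameter T0) \<and>
    (\<forall>(\<Omega> :: (real^3) set) (\<G> :: nat \<Rightarrow> (real^3) set set).
       bounded_polyhedral_domain \<Omega> \<longrightarrow> tetrahedral_partition \<Omega> (\<G> 0) \<longrightarrow>
       (\<forall>k. le_section_step n (\<G> k) (\<G> (Suc k))) \<longrightarrow>
       (\<lambda>k. mesh_size (\<G> k)) \<longlonglongrightarrow> 0)"
proof (intro conjI allI impI)
  show "contraction_factor n < 1" by (rule contraction_factor_bounds(2)[OF assms])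
next
  fix T0 T :: "(real^3) set" and k :: nat
  assume "tetrahedron T0" "descendant n T0 k T"
  then show "diameter T \<le> contraction_factor n ^ (k div 6) * diameter T0"
    using sections_contract[OF assms] by (simp add: descendant_iff_relpowp)
next
  fix \<Omega> :: "(real^3) set" and \<G> :: "nat \<Rightarrow> (real^3) set set"
  assume \<Omega>: "bounded_polyhedral_domain \<Omega>" and part: "tetrahedral_partition \<Omega> (\<G> 0)"
    and step: "\<forall>k. le_section_step n (\<G> k) (\<G> (Suc k))"
  \<comment> \<open>A domain is nonempty, and so is any partition of it.\<close>
  have "\<G> 0 \<noteq> {}"
    using \<Omega> part closure_subset[of \<Omega>]
    by (auto simp: bounded_polyhedral_domain_def tetrahedral_partition_def)
  then show "(\<lambda>k. mesh_size (\<G> k)) \<longlonglongrightarrow> 0"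
    using part mesh_size_tendsto_0[OF assms _ _ _ step] by (simp add: tetrahedral_partition_def)
qed

end
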